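(* Let $G$ be a locally compact group with right Haar measure $\lambda$, let $1\le p<\infty$, let $a\in G$ be a torsion element of order $\gamma$, and let $\omega:G\to(0,\infty)$ be a weight function. Then the following conditions are equivalent: (i) $J_{T_{a,\omega}}(0)=L^p(G)$; (ii) for every compact set $F\subseteq G$ of positive measure and every $\epsilon,\delta>0$ there exist $n\in\mathbb{N}$ and a Borel subset $E\subseteq F$ such that $\lambda(F\setminus E)<\delta$ and $$\underset{x\in E}{\mathrm{ess\,sup}}\ \omega_n(x)^{-1}<\epsilon.$$
   Context: $L^p(G)$ is the complex $L^p$-space of Borel functions with respect to $\lambda$. An element $a\in G$ is a torsion element if $a^n=e$ (the identity) for some $n\in\mathbb{N}$; its order is its order as a group element. A weight is a continuous function $\omega:G\to(0,\infty)$. The weighted translation operator $T_{a,\omega}:L^p(G)\to L^p(G)$ is $(T_{a,\omega}f)(x)=\omega(x)f(xa^{-1})$; $\omega$ is assumed to be such that this is a bounded linear operator on $L^p(G)$. For $m\in\mathbb{N}$ (positive integers), $\omega_m(x)=\prod_{i=1}^{m}\omega(xa^{i})$. For a bounded linear operator $T$ on a Banach space $X$ (not necessarily separable) and $x\in X$, the extended limit set $J_T(x)$ is the set of all $y\in X$ for which there exist a strictly increasing sequence of positive integers $(n_k)$ and a sequence $(x_k)$ in $X$ with $x_k\to x$ and $T^{n_k}x_k\to y$. *)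

theory Defs
  imports "HOL-Analysis.Analysis" "HOL-Probability.Essential_Supremum"
begin

text \<open>
  Groups are written additively, since \<open>group_add\<close> and \<open>topological_group_add\<close> are the classes of
  possibly non-commutative (topological) groups: \<open>x + y\<close> stands for the product of \<open>x\<close> and \<open>y\<close>,
  \<open>x - a\<close> for \<open>x\<close> times the inverse of \<open>a\<close>, and \<open>0\<close> for the identity.
\<close>

definition multiple :: "nat \<Rightarrow> 'a::monoid_add \<Rightarrow> 'a" where
  "multiple n a = ((+) a ^^ n) 0"

definition has_order :: "'a::monoid_add \<Rightarrow> nat \<Rightarrow> bool" where
  "has_order a \<gamma> \<longleftrightarrow> \<gamma> > 0 \<and> multiple \<gamma> a = 0 \<and> (\<forall>m. 0 < m \<and> m < \<gamma> \<longrightarrow> multiple m a \<noteq> 0)"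

text \<open>
  A right Haar measure is a nonzero right-invariant Radon measure on the Borel sets. Radon means:
  finite on compact sets, outer regular on Borel sets and inner regular on open sets.
\<close>

definition right_haar_measure :: "'a::{topological_group_add,t2_space} measure \<Rightarrow> bool" where
  "right_haar_measure M \<longleftrightarrow>
     sets M = sets borel \<and>
     emeasure M UNIV \<noteq> 0 \<and>
     (\<forall>A\<in>sets borel. \<forall>g. emeasure M ((\<lambda>x. x + g) ` A) = emeasure M A) \<and>
     (\<forall>K. compact K \<longrightarrow> emeasure M K < \<infinity>) \<and>
     (\<forall>A\<in>sets borel. emeasure M A = (INF U\<in>{U. open U \<and> A \<subseteq> U}. emeasure M U)) \<and>
     (\<forall>U. open U \<longrightarrow> emeasure M U = (SUP K\<in>{K. compact K \<and> K \<subseteq> U}. emeasure M K))"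


subsection \<open>Complex \<open>L\<^sup>p\<close> spaces\<close>

definition Lp_funs :: "'a measure \<Rightarrow> real \<Rightarrow> ('a \<Rightarrow> complex) set" where
  "Lp_funs M p = {f \<in> borel_measurable M. integrable M (\<lambda>x. norm (f x) powr p)}"

definition Lp_norm :: "'a measure \<Rightarrow> real \<Rightarrow> ('a \<Rightarrow> complex) \<Rightarrow> real" where
  "Lp_norm M p f = (\<integral>x. norm (f x) powr p \<partial>M) powr (1 / p)"

definition Lp_class :: "'a measure \<Rightarrow> real \<Rightarrow> ('a \<Rightarrow> complex) \<Rightarrow> ('a \<Rightarrow> complex) set" where
  "Lp_class M p f = {g \<in> Lp_funs M p. AE x in M. g x = f x}"

definition Lp_space :: "'a measure \<Rightarrow> real \<Rightarrow> ('a \<Rightarrow> complex) set set" where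
  "Lp_space M p = Lp_class M p ` Lp_funs M p"

text \<open>
  The distance of two classes, and the action on classes of an operator given on functions, are
  computed on arbitrarily chosen representatives; \<open>Lp_dist_class\<close> and \<open>Lp_lift_class\<close> below show
  that the choice is immaterial.
\<close>

definition Lp_rep :: "('a \<Rightarrow> complex) set \<Rightarrow> 'a \<Rightarrow> complex" where
  "Lp_rep A = (SOME f. f \<in> A)"

definition Lp_dist :: "'a measure \<Rightarrow> real \<Rightarrow> ('a \<Rightarrow> complex) set \<Rightarrow> ('a \<Rightarrow> complex) set \<Rightarrow> real" where
  "Lp_dist M p A B = Lp_norm M p (\<lambda>x. Lp_rep A x - Lp_rep B x)"

definition Lp_lift ::
  "'a measure \<Rightarrow> real \<Rightarrow> (('a \<Rightarrow> complex) \<Rightarrow> 'a \<Rightarrow> complex) \<Rightarrow> ('a \<Rightarrow> complex) set \<Rightarrow> ('a \<Rightarrow> complex) set" where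
  "Lp_lift M p S A = Lp_class M p (S (Lp_rep A))"

definition Lp_bounded_linear ::
  "'a measure \<Rightarrow> real \<Rightarrow> (('a \<Rightarrow> complex) \<Rightarrow> 'a \<Rightarrow> complex) \<Rightarrow> bool" where
  "Lp_bounded_linear M p S \<longleftrightarrow>
     (\<forall>f\<in>Lp_funs M p. S f \<in> Lp_funs M p) \<and>
     (\<forall>f\<in>Lp_funs M p. \<forall>g\<in>Lp_funs M p. AE x in M. S (\<lambda>x. f x + g x) x = S f x + S g x) \<and>
     (\<forall>c. \<forall>f\<in>Lp_funs M p. AE x in M. S (\<lambda>x. c * f x) x = c * S f x) \<and>
     (\<exists>C. \<forall>f\<in>Lp_funs M p. Lp_norm M p (S f) \<le> C * Lp_norm M p f)"


subsection \<open>Extended limit sets\<close>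

text \<open>\<open>X\<close> is the carrier of the Banach space and \<open>d\<close> its norm distance.\<close>

definition extended_limit_set ::
  "'b set \<Rightarrow> ('b \<Rightarrow> 'b \<Rightarrow> real) \<Rightarrow> ('b \<Rightarrow> 'b) \<Rightarrow> 'b \<Rightarrow> 'b set" where
  "extended_limit_set X d T x =
     {y \<in> X. \<exists>(n :: nat \<Rightarrow> nat) u.
        strict_mono n \<and> (\<forall>k. n k > 0) \<and> (\<forall>k. u k \<in> X) \<and>
        (\<lambda>k. d (u k) x) \<longlonglongrightarrow> 0 \<and> (\<lambda>k. d ((T ^^ n k) (u k)) y) \<longlonglongrightarrow> 0}"


subsection \<open>Weighted translations\<close>

definition weight :: "('a::topological_space \<Rightarrow> real) \<Rightarrow> bool" where
  "weight \<omega> \<longleftrightarrow> continuous_on UNIV \<omega> \<and> (\<forall>x. \<omega> x > 0)"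

definition weighted_translation ::
  "'a::group_add \<Rightarrow> ('a \<Rightarrow> real) \<Rightarrow> ('a \<Rightarrow> complex) \<Rightarrow> 'a \<Rightarrow> complex" where
  "weighted_translation a \<omega> f x = complex_of_real (\<omega> x) * f (x - a)"

definition weight_prod :: "'a::group_add \<Rightarrow> ('a \<Rightarrow> real) \<Rightarrow> nat \<Rightarrow> 'a \<Rightarrow> real" where
  "weight_prod a \<omega> m x = (\<Prod>i=1..m. \<omega> (x + multiple i a))"


subsection \<open>Independence of representatives\<close>

lemma Lp_rep_class:
  assumes "f \<in> Lp_funs M p"
  shows "Lp_rep (Lp_class M p f) \<in> Lp_class M p f"
proof -
  have "f \<in> Lp_class M p f" using assms by (simp add: Lp_class_def)
  then show ?thesis unfolding Lp_rep_def by (rule someI[where P = "\<lambda>h. h \<in> Lp_class M p f"])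
qed

lemma Lp_class_cong:
  assumes "AE x in M. f x = g x"
  shows "Lp_class M p f = Lp_class M p g"
proof -
  have "(AE x in M. h x = f x) \<longleftrightarrow> (AE x in M. h x = g x)" for h
    using assms by (auto elim: eventually_elim2)
  then show ?thesis by (simp add: Lp_class_def)
qed

lemma Lp_dist_class:
  assumes "f \<in> Lp_funs M p" "g \<in> Lp_funs M p"
  shows "Lp_dist M p (Lp_class M p f) (Lp_class M p g) = Lp_norm M p (\<lambda>x. f x - g x)"
proof -
  let ?f = "Lp_rep (Lp_class M p f)" and ?g = "Lp_rep (Lp_class M p g)"
  have f: "?f \<in> Lp_class M p f" and g: "?g \<in> Lp_class M p g"
    using assms by (simp_all add: Lp_rep_class)
  have [measurable]: "f \<in> borel_measurable M" "g \<in> borel_measurable M"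
    "?f \<in> borel_measurable M" "?g \<in> borel_measurable M"
    using assms f g by (auto simp: Lp_class_def Lp_funs_def)
  have "AE x in M. ?f x = f x" "AE x in M. ?g x = g x"
    using f g by (auto simp: Lp_class_def)
  then have "(\<integral>x. norm (?f x - ?g x) powr p \<partial>M) = (\<integral>x. norm (f x - g x) powr p \<partial>M)"
    by (intro integral_cong_AE) auto
  then show ?thesis by (simp add: Lp_dist_def Lp_norm_def)
qed

lemma Lp_lift_class:
  assumes M: "right_haar_measure M" and f: "f \<in> Lp_funs M p"
  shows "Lp_lift M p (weighted_translation a \<omega>) (Lp_class M p f)
    = Lp_class M p (weighted_translation a \<omega> f)"
proof -
  let ?f = "Lp_rep (Lp_class M p f)"
  have sets: "sets M = sets borel" using M by (simp add: right_haar_measure_def)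
  then have space: "space M = UNIV" by (metis sets_eq_imp_space_eq space_borel)
  have "AE x in M. ?f x = f x"
    using Lp_rep_class[OF f] by (simp add: Lp_class_def)
  then obtain N where N: "N \<in> sets M" "emeasure M N = 0" "{x. ?f x \<noteq> f x} \<subseteq> N"
    by (auto simp: space elim!: AE_E)
  have "continuous_on UNIV (\<lambda>x::'a. x - a)"
    by (intro continuous_intros)
  then have "(\<lambda>x. x - a) -` N \<in> sets borel"
    using N(1) measurable_sets[OF borel_measurable_continuous_onI, of "\<lambda>x. x - a" N]
    by (simp add: sets)
  moreover have "(\<lambda>x. x - a) -` N = (\<lambda>x. x + a) ` N"
    by (auto simp: image_iff) (metis diff_add_cancel)
  moreover have "emeasure M ((\<lambda>x. x + a) ` N) = 0"
    using M N(1,2) unfolding right_haar_measure_def by metis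
  ultimately have "(\<lambda>x. x + a) ` N \<in> null_sets M"
    by (simp add: null_sets_def sets)
  moreover have "{x \<in> space M. ?f (x - a) \<noteq> f (x - a)} \<subseteq> (\<lambda>x. x + a) ` N"
    using N(3) by (auto simp: image_iff) (metis (mono_tags, lifting) diff_add_cancel mem_Collect_eq subsetD)
  ultimately have "AE x in M. ?f (x - a) = f (x - a)"
    by (rule AE_I')
  then show ?thesis
    unfolding Lp_lift_def
    by (intro Lp_class_cong) (auto simp: weighted_translation_def)
qed

end

theory Submission
  imports Defs
begin

text \<open>
  Let \<open>W = \<omega>\<^sub>\<gamma>\<close>. Since \<open>a\<close> has order \<open>\<gamma>\<close>, the power \<open>T ^ \<gamma>\<close> is multiplication by \<open>W\<close>, and
  \<open>\<omega>\<^bsub>q\<gamma> + r\<^esub> = W ^ q * \<omega>\<^sub>r\<close>. Both conditions are equivalent to \<open>W > 1\<close> almost everywhere on every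
  compact set: on \<open>{W \<le> 1}\<close> neither \<open>T ^ n\<close> nor \<open>\<omega>\<^sub>n\<close> can grow beyond the bounds attained for
  \<open>n < \<gamma>\<close>. Conversely, if \<open>W > 1\<close> almost everywhere where \<open>f\<close> does not vanish, then
  \<open>W ^ (-k) * f\<close> tends to \<open>0\<close> by dominated convergence and is mapped to \<open>f\<close> by \<open>T ^ (k * \<gamma>)\<close>.
\<close>

subsection \<open>Iterated weighted translations\<close>

lemma multiple_0 [simp]: "multiple 0 a = 0"
  by (simp add: multiple_def)

lemma multiple_Suc: "multiple (Suc n) a = a + multiple n a"
  by (simp add: multiple_def)

lemma multiple_add: "multiple (m + n) a = multiple m a + multiple n a"
  by (induction m) (simp_all add: multiple_Suc add.assoc)

text \<open>The group may be non-commutative, but powers of \<open>a\<close> commute with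
  \<open>a\<close> by the addition law. This form is what iterated translations by
  \<open>- a\<close> require.\<close>

lemma multiple_Suc_right: "multiple (Suc n) a = multiple n a + a"
  using multiple_add[of n 1 a] by (simp add: multiple_Suc)

lemma weight_prod_pos: "weight \<omega> \<Longrightarrow> weight_prod a \<omega> n x > 0"
  unfolding weight_prod_def weight_def by (auto intro: prod_pos)

lemma continuous_on_weight_prod:
  fixes a :: "'a::topological_group_add"
  assumes "weight \<omega>"
  shows "continuous_on A (weight_prod a \<omega> n)"
proof -
  have "continuous_on UNIV \<omega>"
    using assms by (simp add: weight_def)
  then have "continuous_on A (\<lambda>x. \<omega> (x + multiple i a))" for i
    by (rule continuous_on_compose2) (auto intro!: continuous_intros)
  then have "continuous_on A (\<lambda>x. \<Prod>i=1..n. \<omega> (x + multiple i a))"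
    by (intro continuous_on_prod)
  then show ?thesis
    by (simp add: weight_prod_def[abs_def])
qed

lemma borel_measurable_weight_prod:
  fixes a :: "'a::topological_group_add"
  assumes "weight \<omega>"
  shows "weight_prod a \<omega> n \<in> borel_measurable borel"
  using assms by (intro borel_measurable_continuous_onI continuous_on_weight_prod)

text \<open>The factors repeat with period \<open>\<gamma>\<close>, because
  \<open>multiple (i + \<gamma>) a = multiple i a\<close>.\<close>

lemma weight_prod_add_period:
  fixes a :: "'a::group_add"
  assumes "multiple \<gamma> a = 0"
  shows "weight_prod a \<omega> (\<gamma> + n) x = weight_prod a \<omega> \<gamma> x * weight_prod a \<omega> n x"
proof -
  have "(\<Prod>i=\<gamma>+1..\<gamma>+n. \<omega> (x + multiple i a)) = (\<Prod>i=1..n. \<omega> (x + multiple (i + \<gamma>) a))"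
    using prod.shift_bounds_cl_nat_ivl[of "\<lambda>i. \<omega> (x + multiple i a)" 1 \<gamma> n] by (simp add: add.commute)
  also have "\<dots> = weight_prod a \<omega> n x"
    by (simp add: weight_prod_def multiple_add assms)
  finally show ?thesis
    unfolding weight_prod_def by (subst prod.ub_add_nat) simp_all
qed

text \<open>Induction on \<open>q\<close> peels off one period at a time. With
  \<open>q = n div \<gamma>\<close> and \<open>r = n mod \<gamma>\<close> this reduces all weight
  products to powers of \<open>W\<close> and finitely many remainders.\<close>

lemma weight_prod_period_mult_add:
  fixes a :: "'a::group_add"
  assumes "multiple \<gamma> a = 0"
  shows "weight_prod a \<omega> (q * \<gamma> + r) x = weight_prod a \<omega> \<gamma> x ^ q * weight_prod a \<omega> r x"
proof (induction q)
  case (Suc q)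
  have "weight_prod a \<omega> (Suc q * \<gamma> + r) x = weight_prod a \<omega> (\<gamma> + (q * \<gamma> + r)) x"
    by (simp add: add.assoc)
  then show ?case
    by (simp add: weight_prod_add_period[OF assms] Suc mult.assoc)
qed simp

text \<open>The iterate collects the weights at \<open>x\<close>, \<open>x - a\<close>, and so on
  for \<open>n\<close> points. Seen from the far end \<open>y = x - multiple n a\<close> these are
  the points \<open>y + multiple i a\<close> with \<open>i\<close> from 1 to \<open>n\<close>, hence
  the shifted argument.\<close>

lemma funpow_weighted_translation:
  "(weighted_translation a \<omega> ^^ n) f x =
    complex_of_real (weight_prod a \<omega> n (x - multiple n a)) * f (x - multiple n a)"
proof (induction n arbitrary: x)
  case 0
  then show ?case by (simp add: weight_prod_def)
next
  case (Suc n)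
  define y where "y = x - multiple (Suc n) a"
  \<comment> \<open>Subtracting a sum reverses its terms, so \<open>a\<close> has to be split off
    from \<open>multiple (Suc n) a\<close> on the right.\<close>
  have y: "x - a - multiple n a = y"
    by (simp add: y_def multiple_Suc_right diff_add_eq_diff_diff_swap)
  have "x = y + multiple (Suc n) a"
    by (simp add: y_def)
  then have "weight_prod a \<omega> (Suc n) y = \<omega> x * weight_prod a \<omega> n y"
    by (simp add: weight_prod_def mult.commute)
  then show ?case
    unfolding y_def[symmetric]
    by (simp add: weighted_translation_def[of a \<omega> "(weighted_translation a \<omega> ^^ n) f"] Suc y)
qed

lemma funpow_weighted_translation_period:
  fixes a :: "'a::group_add"
  assumes "multiple \<gamma> a = 0"
  shows "(weighted_translation a \<omega> ^^ (q * \<gamma>)) f x = complex_of_real (weight_prod a \<omega> \<gamma> x ^ q) * f x"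
proof -
  have "multiple (q * \<gamma>) a = 0"
    by (induction q) (simp_all add: multiple_add assms)
  moreover have "weight_prod a \<omega> (q * \<gamma>) x = weight_prod a \<omega> \<gamma> x ^ q"
    using weight_prod_period_mult_add[OF assms, where r = 0 and q = q and x = x and \<omega> = \<omega>]
    by (simp add: weight_prod_def)
  ultimately show ?thesis
    by (simp add: funpow_weighted_translation)
qed


subsection \<open>Haar measures\<close>

lemma right_haar_measure_sets: "right_haar_measure M \<Longrightarrow> sets M = sets borel"
  by (simp add: right_haar_measure_def)

lemma right_haar_measure_compact: "right_haar_measure M \<Longrightarrow> compact K \<Longrightarrow> emeasure M K < \<infinity>"
  by (simp add: right_haar_measure_def)

text \<open>The definition grants inner regularity on open sets only. For a Borel set of finite
  measure it follows by combining this with outer regularity, applied to the set and to its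
  complement in an open superset.\<close>

lemma right_haar_measure_null_if_compact_null:
  assumes M: "right_haar_measure M" and A: "A \<in> sets borel" and fin: "emeasure M A < \<infinity>"
    and null: "\<And>K. compact K \<Longrightarrow> K \<subseteq> A \<Longrightarrow> emeasure M K = 0"
  shows "emeasure M A = 0"
proof (rule ccontr)
  assume nz: "emeasure M A \<noteq> 0"
  note sets = right_haar_measure_sets[OF M]
  have outer: "\<exists>U. open U \<and> B \<subseteq> U \<and> emeasure M U < c"
    if "B \<in> sets borel" "emeasure M B < c" for B c
  proof -
    have "emeasure M B = (INF U\<in>{U. open U \<and> B \<subseteq> U}. emeasure M U)"
      using M that(1) unfolding right_haar_measure_def by blast
    then show ?thesis using that(2) by (auto simp: INF_less_iff)
  qed
  have inner: "\<exists>K. compact K \<and> K \<subseteq> U \<and> c < emeasure M K" if "open U" "c < emeasure M U" for U c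
  proof -
    have "emeasure M U = (SUP K\<in>{K. compact K \<and> K \<subseteq> U}. emeasure M K)"
      using M that(1) unfolding right_haar_measure_def by blast
    then show ?thesis using that(2) by (auto simp: less_SUP_iff)
  qed
  obtain r where r: "emeasure M A = ennreal r" "r > 0"
    using nz fin by (cases "emeasure M A") (auto simp: less_le)
  obtain U where U: "open U" "A \<subseteq> U" "emeasure M U < ennreal (r + r / 2)"
    using outer[OF A, of "ennreal (r + r / 2)"] r by (auto simp: ennreal_lessI)
  have "emeasure M (U - A) = emeasure M U - emeasure M A"
    using A U fin by (intro emeasure_Diff) (auto simp: sets)
  also have "\<dots> < ennreal (r / 2)"
    using U(3) r by (cases "emeasure M U") (auto intro!: ennreal_lessI simp: ennreal_minus ennreal_less_iff)
  finally obtain V where V: "open V" "U - A \<subseteq> V" "emeasure M V < ennreal (r / 2)"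
    using outer[of "U - A"] A U(1) by (auto intro: borel_open)
  have "ennreal (r / 2) < emeasure M A"
    using r by (simp add: ennreal_lessI)
  also have "\<dots> \<le> emeasure M U"
    using U by (intro emeasure_mono) (auto simp: sets)
  finally obtain K where K: "compact K" "K \<subseteq> U" "ennreal (r / 2) < emeasure M K"
    using inner[OF U(1)] by blast
  \<comment> \<open>\<open>K\<close> lies in \<open>U\<close> and \<open>V\<close> covers
    \<open>U - A\<close>, so \<open>K - V\<close> is a compact subset of \<open>A\<close>. As
    \<open>K\<close> has measure above \<open>r / 2\<close> and \<open>V\<close> below it,
    \<open>K - V\<close> cannot be null.\<close>
  have KV: "compact (K - V)"
    using K(1) V(1) by (rule compact_diff)
  have "emeasure M K \<le> emeasure M ((K - V) \<union> V)"
    using borel_compact[OF K(1)] borel_open[OF V(1)] by (intro emeasure_mono) (auto simp: sets)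
  also have "\<dots> \<le> emeasure M (K - V) + emeasure M V"
    using KV V(1) by (intro emeasure_subadditive) (auto simp: sets intro: borel_compact)
  also have "emeasure M (K - V) = 0"
    using KV K(2) V(2) by (intro null) auto
  finally show False
    using K(3) V(3) by simp
qed


subsection \<open>The spaces \<open>L\<^sup>p\<close>\<close>

text \<open>The norm of a sum is at most twice the larger norm. The crude constant suffices for
  integrability and for limits equal to 0, so Minkowski's inequality is avoided.\<close>

lemma powr_norm_add_le:
  fixes x y :: "'b::real_normed_vector"
  assumes "0 \<le> p"
  shows "norm (x + y) powr p \<le> 2 powr p * (norm x powr p + norm y powr p)"
proof -
  have "norm (x + y) \<le> 2 * max (norm x) (norm y)"
    using norm_triangle_ineq[of x y] by linarith
  then have "norm (x + y) powr p \<le> (2 * max (norm x) (norm y)) powr p"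
    using assms by (intro powr_mono2) auto
  also have "\<dots> = 2 powr p * max (norm x) (norm y) powr p"
    by (simp add: powr_mult)
  also have "max (norm x) (norm y) powr p \<le> norm x powr p + norm y powr p"
    by (simp add: max_def)
  finally show ?thesis by simp
qed

lemma Lp_funs_diff:
  assumes "0 \<le> p" "f \<in> Lp_funs M p" "g \<in> Lp_funs M p"
  shows "(\<lambda>x. f x - g x) \<in> Lp_funs M p"
proof -
  have [measurable]: "f \<in> borel_measurable M" "g \<in> borel_measurable M"
    and int: "integrable M (\<lambda>x. norm (f x) powr p)" "integrable M (\<lambda>x. norm (g x) powr p)"
    using assms by (auto simp: Lp_funs_def)
  have "integrable M (\<lambda>x. norm (f x - g x) powr p)"
  proof (rule Bochner_Integration.integrable_bound)
    show "integrable M (\<lambda>x. 2 powr p * (norm (f x) powr p + norm (g x) powr p))"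
      using int by simp
    show "AE x in M. norm (norm (f x - g x) powr p)
        \<le> norm (2 powr p * (norm (f x) powr p + norm (g x) powr p))"
      using powr_norm_add_le[OF assms(1), of "f _" "- g _"] by simp
  qed measurable
  then show ?thesis by (simp add: Lp_funs_def)
qed

lemma Lp_funs_zero: "(\<lambda>_. 0) \<in> Lp_funs M p"
  by (simp add: Lp_funs_def)

lemma Lp_norm_nonneg: "0 \<le> Lp_norm M p f"
  by (simp add: Lp_norm_def)

lemma Lp_norm_powr:
  assumes "0 < p"
  shows "Lp_norm M p f powr p = (\<integral>x. norm (f x) powr p \<partial>M)"
  using assms by (simp add: Lp_norm_def powr_powr)

text \<open>Taking powers \<open>p\<close> and \<open>1 / p\<close> preserves convergence to 0. Norm
  convergence can thus be tested on integrals, where pointwise bounds and dominated convergence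
  apply.\<close>

lemma Lp_norm_tendsto_0_iff:
  assumes "0 < p"
  shows "(\<lambda>k. Lp_norm M p (f k)) \<longlonglongrightarrow> 0 \<longleftrightarrow> (\<lambda>k. \<integral>x. norm (f k x) powr p \<partial>M) \<longlonglongrightarrow> 0"
proof
  assume "(\<lambda>k. Lp_norm M p (f k)) \<longlonglongrightarrow> 0"
  then have "(\<lambda>k. Lp_norm M p (f k) powr p) \<longlonglongrightarrow> 0"
    using assms by (intro tendsto_zero_powrI[where b = p]) (auto simp: Lp_norm_nonneg)
  then show "(\<lambda>k. \<integral>x. norm (f k x) powr p \<partial>M) \<longlonglongrightarrow> 0"
    by (simp add: Lp_norm_powr assms)
next
  assume "(\<lambda>k. \<integral>x. norm (f k x) powr p \<partial>M) \<longlonglongrightarrow> 0"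
  then show "(\<lambda>k. Lp_norm M p (f k)) \<longlonglongrightarrow> 0"
    unfolding Lp_norm_def
    using assms by (intro tendsto_zero_powrI[where b = "1 / p"]) auto
qed

section \<open>Powers of bounded operators and their action on classes\<close>

lemma Lp_bounded_linear_funpow:
  assumes "Lp_bounded_linear M p S" "f \<in> Lp_funs M p"
  shows "(S ^^ n) f \<in> Lp_funs M p"
  using assms by (induction n) (auto simp: Lp_bounded_linear_def)

text \<open>Provides one constant for all remainders \<open>n mod \<gamma>\<close> at once.\<close>

lemma Lp_bounded_linear_funpow_bound:
  assumes S: "Lp_bounded_linear M p S"
  shows "\<exists>D\<ge>0. \<forall>n<m. \<forall>f\<in>Lp_funs M p. Lp_norm M p ((S ^^ n) f) \<le> D * Lp_norm M p f"
proof -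
  obtain C where C: "\<And>f. f \<in> Lp_funs M p \<Longrightarrow> Lp_norm M p (S f) \<le> C * Lp_norm M p f"
    using S unfolding Lp_bounded_linear_def by blast
  \<comment> \<open>With a base of at least 1 the powers increase, so \<open>B ^ m\<close> dominates
    all \<open>B ^ n\<close> with \<open>n < m\<close>.\<close>
  define B where "B = max 1 C"
  have B: "B \<ge> 1" by (simp add: B_def)
  have SB: "Lp_norm M p (S f) \<le> B * Lp_norm M p f" if "f \<in> Lp_funs M p" for f
    using C[OF that] mult_right_mono[OF _ Lp_norm_nonneg, of C B M p f] by (simp add: B_def)
  have pow: "Lp_norm M p ((S ^^ n) f) \<le> B ^ n * Lp_norm M p f" if f: "f \<in> Lp_funs M p" for n f
  proof (induction n)
    case (Suc n)
    have "Lp_norm M p (S ((S ^^ n) f)) \<le> B * Lp_norm M p ((S ^^ n) f)"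
      using f by (intro SB Lp_bounded_linear_funpow[OF S])
    also have "\<dots> \<le> B * (B ^ n * Lp_norm M p f)"
      using Suc B by (intro mult_left_mono) auto
    finally show ?case by (simp add: mult.assoc)
  qed simp
  have "Lp_norm M p ((S ^^ n) f) \<le> B ^ m * Lp_norm M p f" if "n < m" "f \<in> Lp_funs M p" for n f
  proof -
    have "B ^ n * Lp_norm M p f \<le> B ^ m * Lp_norm M p f"
      using B that by (intro mult_right_mono power_increasing Lp_norm_nonneg) auto
    then show ?thesis using pow[OF that(2), of n] by linarith
  qed
  then show ?thesis
    using B by (intro exI[of _ "B ^ m"]) auto
qed

lemma funpow_Lp_lift_class:
  assumes "right_haar_measure M" "Lp_bounded_linear M p (weighted_translation a \<omega>)" "f \<in> Lp_funs M p"
  shows "(Lp_lift M p (weighted_translation a \<omega>) ^^ n) (Lp_class M p f)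
    = Lp_class M p ((weighted_translation a \<omega> ^^ n) f)"
  by (induction n) (simp_all add: Lp_lift_class assms Lp_bounded_linear_funpow)

lemma Lp_dist_class_zero:
  assumes "f \<in> Lp_funs M p"
  shows "Lp_dist M p (Lp_class M p f) (Lp_class M p (\<lambda>_. 0)) = Lp_norm M p f"
  using Lp_dist_class[OF assms Lp_funs_zero] by simp

lemma indicator_in_Lp_funs:
  assumes "A \<in> sets M" "emeasure M A < \<infinity>"
  shows "indicator A \<in> Lp_funs M p"
proof -
  have "(\<lambda>x. norm (indicator A x :: complex) powr p) = indicator A"
    by (auto simp: fun_eq_iff indicator_def)
  then show ?thesis
    using assms by (simp add: Lp_funs_def)
qed


subsection \<open>Reduction to the weight over one period\<close>

text \<open>Necessity is tested on the target \<open>indicator F\<close>, which cannot be approached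
  on a non-null set where \<open>W \<le> 1\<close>. For sufficiency, a null sequence is built whose
  images all equal the given target.\<close>

lemma extended_limit_set_zero_eq_Lp_space_iff:
  fixes M :: "'a::{topological_group_add,t2_space} measure"
  assumes M: "right_haar_measure M" and p: "0 < p" and \<gamma>: "0 < \<gamma>" "multiple \<gamma> a = 0"
    and \<omega>: "weight \<omega>" and T: "Lp_bounded_linear M p (weighted_translation a \<omega>)"
  shows "extended_limit_set (Lp_space M p) (Lp_dist M p)
      (Lp_lift M p (weighted_translation a \<omega>)) (Lp_class M p (\<lambda>_. 0)) = Lp_space M p
    \<longleftrightarrow> (\<forall>F. compact F \<longrightarrow> emeasure M (F \<inter> {x. weight_prod a \<omega> \<gamma> x \<le> 1}) = 0)"
    (is "?J = _ \<longleftrightarrow> ?N")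
proof -
  define W where "W = weight_prod a \<omega> \<gamma>"
  define S where "S = weighted_translation a \<omega>"
  define A where "A = {x. W x \<le> 1}"
  note sets = right_haar_measure_sets[OF M]
  have W_pos: "W x > 0" for x
    by (simp add: W_def weight_prod_pos \<omega>)
  have W_borel: "W \<in> borel_measurable borel"
    unfolding W_def by (rule borel_measurable_weight_prod[OF \<omega>])
  then have W_meas [measurable]: "W \<in> borel_measurable M"
    by (simp add: measurable_cong_sets[OF sets refl])
  have A_borel: "A \<in> sets borel"
    using W_borel unfolding A_def by measurable
  have S: "Lp_bounded_linear M p S"
    using T by (simp add: S_def)
  have S_period: "(S ^^ (q * \<gamma>)) f x = complex_of_real (W x ^ q) * f x" for q f x
    unfolding S_def W_def by (rule funpow_weighted_translation_period[OF \<gamma>(2)])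
  have lift: "(Lp_lift M p S ^^ n) (Lp_class M p f) = Lp_class M p ((S ^^ n) f)"
    if "f \<in> Lp_funs M p" for f n
    unfolding S_def by (rule funpow_Lp_lift_class[OF M T that])
  have "?J = Lp_space M p \<longleftrightarrow> Lp_space M p \<subseteq> ?J"
    by (auto simp: extended_limit_set_def)
  also have "\<dots> \<longleftrightarrow> ?N"
  proof (intro iffI allI impI)
    fix F :: "'a set"
    assume J: "Lp_space M p \<subseteq> ?J" and F: "compact F"
    have F_sets: "F \<in> sets M"
      using F by (auto simp: sets intro: borel_compact)
    have FA_sets: "F \<inter> A \<in> sets M"
      using F_sets A_borel by (simp add: sets)
    have F_Lp: "indicator F \<in> Lp_funs M p"
      using F_sets right_haar_measure_compact[OF M F] by (rule indicator_in_Lp_funs)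
    then have "Lp_class M p (indicator F) \<in> ?J"
      using J by (auto simp: Lp_space_def)
    then obtain n :: "nat \<Rightarrow> nat" and u where n: "strict_mono n" and u: "\<And>k. u k \<in> Lp_space M p"
      and u_lim: "(\<lambda>k. Lp_dist M p (u k) (Lp_class M p (\<lambda>_. 0))) \<longlonglongrightarrow> 0"
      and Tu_lim: "(\<lambda>k. Lp_dist M p ((Lp_lift M p S ^^ n k) (u k)) (Lp_class M p (indicator F))) \<longlonglongrightarrow> 0"
      unfolding extended_limit_set_def S_def by blast
    have "\<forall>k. \<exists>f. f \<in> Lp_funs M p \<and> u k = Lp_class M p f"
      using u by (auto simp: Lp_space_def)
    then obtain f where f: "\<And>k. f k \<in> Lp_funs M p" and u_eq: "\<And>k. u k = Lp_class M p (f k)"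
      by metis
    \<comment> \<open>\<open>w k\<close> is the full image and \<open>v k\<close> the part below one
      period. They differ by the factor \<open>W ^ (n k div \<gamma>)\<close>, so \<open>w k\<close>
      is dominated by \<open>v k\<close> on \<open>A\<close>.\<close>
    define v where "v k = (S ^^ (n k mod \<gamma>)) (f k)" for k
    define w where "w k = (S ^^ n k) (f k)" for k
    have v: "v k \<in> Lp_funs M p" and w: "w k \<in> Lp_funs M p" for k
      unfolding v_def w_def by (rule Lp_bounded_linear_funpow[OF S f])+
    have wv: "w k x = complex_of_real (W x ^ (n k div \<gamma>)) * v k x" for k x
    proof -
      have "w k = (S ^^ (n k div \<gamma> * \<gamma> + n k mod \<gamma>)) (f k)"
        by (simp add: w_def)
      then show ?thesis
        unfolding v_def S_period[symmetric] by (simp only: funpow_add o_apply)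
    qed
    have f_lim: "(\<lambda>k. Lp_norm M p (f k)) \<longlonglongrightarrow> 0"
      using u_lim by (simp add: u_eq Lp_dist_class_zero f)
    have w_lim: "(\<lambda>k. Lp_norm M p (\<lambda>x. w k x - indicator F x)) \<longlonglongrightarrow> 0"
      using Tu_lim by (simp add: u_eq lift f Lp_dist_class w F_Lp flip: w_def)
    obtain D where D: "\<And>m g. m < \<gamma> \<Longrightarrow> g \<in> Lp_funs M p \<Longrightarrow>
        Lp_norm M p ((S ^^ m) g) \<le> D * Lp_norm M p g"
      using Lp_bounded_linear_funpow_bound[OF S, of \<gamma>] by blast
    have v_lim: "(\<lambda>k. Lp_norm M p (v k)) \<longlonglongrightarrow> 0"
    proof (rule tendsto_sandwich)
      show "\<forall>\<^sub>F k in sequentially. 0 \<le> Lp_norm M p (v k)"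
        by (simp add: Lp_norm_nonneg)
      show "\<forall>\<^sub>F k in sequentially. Lp_norm M p (v k) \<le> D * Lp_norm M p (f k)"
        unfolding v_def using \<gamma>(1) f by (auto intro!: always_eventually D)
      show "(\<lambda>k. D * Lp_norm M p (f k)) \<longlonglongrightarrow> 0"
        using tendsto_mult_left[OF f_lim, of D] by simp
    qed simp
    let ?I = "\<lambda>k. \<integral>x. norm (w k x - indicator F x) powr p \<partial>M"
    let ?V = "\<lambda>k. \<integral>x. norm (v k x) powr p \<partial>M"
    \<comment> \<open>On \<open>F \<inter> A\<close> the value 1 splits as
      \<open>(1 - w k x) + w k x\<close>, and there \<open>w k x\<close> is bounded in norm by
      \<open>v k x\<close>. The left side is independent of \<open>k\<close> while the right side
      tends to 0.\<close>
    have "measure M (F \<inter> A) \<le> 2 powr p * (?I k + ?V k)" for k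
    proof -
      have int: "integrable M (\<lambda>x. norm (w k x - indicator F x) powr p)"
          "integrable M (\<lambda>x. norm (v k x) powr p)"
        using Lp_funs_diff[OF _ w F_Lp] v p by (auto simp: Lp_funs_def)
      have bound: "indicator (F \<inter> A) x
          \<le> 2 powr p * (norm (w k x - indicator F x) powr p + norm (v k x) powr p)" for x
      proof (cases "x \<in> F \<inter> A")
        case True
        then have "W x ^ (n k div \<gamma>) \<le> 1"
          using W_pos[of x] by (auto simp: A_def intro: power_le_one)
        then have "norm (w k x) \<le> norm (v k x)"
          using W_pos[of x] by (simp add: wv norm_mult norm_power mult_left_le_one_le)
        then have "norm (w k x) powr p \<le> norm (v k x) powr p"
          using p by (intro powr_mono2) auto
        moreover have "1 \<le> 2 powr p * (norm (1 - w k x) powr p + norm (w k x) powr p)"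
          using powr_norm_add_le[of p "1 - w k x" "w k x"] p by simp
        moreover have "norm (w k x - indicator F x) = norm (1 - w k x)"
          using True by (simp add: norm_minus_commute)
        ultimately show ?thesis
          using True by (simp add: distrib_left) (smt (verit) mult_left_mono powr_ge_zero)
      qed simp
      have "measure M (F \<inter> A) = (\<integral>x. indicator (F \<inter> A) x \<partial>M)"
        using FA_sets by simp
      also have "\<dots> \<le> (\<integral>x. 2 powr p * (norm (w k x - indicator F x) powr p + norm (v k x) powr p) \<partial>M)"
      proof (rule integral_mono[OF _ _ bound])
        have "emeasure M (F \<inter> A) \<le> emeasure M F"
          using F_sets by (intro emeasure_mono) auto
        then show "integrable M (indicator (F \<inter> A) :: 'a \<Rightarrow> real)"
          using FA_sets right_haar_measure_compact[OF M F] by simp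
      qed (use int in simp)
      finally show ?thesis
        using int by simp
    qed
    moreover have "(\<lambda>k. 2 powr p * (?I k + ?V k)) \<longlonglongrightarrow> 2 powr p * (0 + 0)"
      using w_lim v_lim unfolding Lp_norm_tendsto_0_iff[OF p] by (intro tendsto_intros)
    ultimately have "measure M (F \<inter> A) \<le> 0"
      by (intro LIMSEQ_le_const[where X = "\<lambda>k. 2 powr p * (?I k + ?V k)"]) auto
    \<comment> \<open>\<open>measure\<close> takes the default value 0 on sets of infinite measure,
      so finiteness is checked before passing back to \<open>emeasure\<close>.\<close>
    moreover have "emeasure M (F \<inter> A) < \<infinity>"
      using emeasure_mono[of "F \<inter> A" F M] F_sets right_haar_measure_compact[OF M F]
      by (auto simp: less_top[symmetric] top_unique)
    ultimately show "emeasure M (F \<inter> {x. weight_prod a \<omega> \<gamma> x \<le> 1}) = 0"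
      using measure_nonneg[of M "F \<inter> A"]
      by (simp add: emeasure_eq_ennreal_measure top.not_eq_extremum flip: W_def A_def)
  next
    assume N: ?N
    show "Lp_space M p \<subseteq> ?J"
    proof
      fix y assume "y \<in> Lp_space M p"
      then obtain f where f: "f \<in> Lp_funs M p" and y: "y = Lp_class M p f"
        by (auto simp: Lp_space_def)
      have [measurable]: "f \<in> borel_measurable M" and f_int: "integrable M (\<lambda>x. norm (f x) powr p)"
        using f by (auto simp: Lp_funs_def)
      have space: "space M = UNIV"
        using sets by (metis sets_eq_imp_space_eq space_borel)
      \<comment> \<open>The hypothesis speaks of compact sets only. These slices of the part of
        \<open>{x. W x \<le> 1}\<close> where \<open>f\<close> is nonzero have finite measure by
        Markov's inequality, so inner regularity makes each of them null.\<close>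
      define B where "B j = {x. W x \<le> 1 \<and> 1 / Suc j \<le> norm (f x) powr p}" for j :: nat
      have B_sets: "B j \<in> sets M" for j
      proof -
        have "{x \<in> space M. W x \<le> 1 \<and> 1 / Suc j \<le> norm (f x) powr p} \<in> sets M"
          by measurable
        then show ?thesis by (simp add: B_def space)
      qed
      have "emeasure M (B j) = 0" for j
      proof (rule right_haar_measure_null_if_compact_null[OF M])
        show "B j \<in> sets borel"
          using B_sets by (simp add: sets)
        have "{x \<in> space M. 1 / Suc j \<le> norm (f x) powr p} \<in> sets M"
          by measurable
        then have "emeasure M (B j) \<le> emeasure M {x \<in> space M. 1 / Suc j \<le> norm (f x) powr p}"
          by (intro emeasure_mono) (auto simp: B_def space)
        also have "\<dots> \<le> ennreal (1 / (1 / Suc j) * (\<integral>x. norm (f x) powr p \<partial>M))"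
          by (rule integral_Markov_inequality[OF f_int]) auto
        also have "\<dots> < \<infinity>"
          by simp
        finally show "emeasure M (B j) < \<infinity>" .
        fix K assume "compact K" "K \<subseteq> B j"
        then have "K = K \<inter> {x. weight_prod a \<omega> \<gamma> x \<le> 1}"
          by (auto simp: B_def W_def)
        then show "emeasure M K = 0"
          using N \<open>compact K\<close> by metis
      qed
      then have "(\<Union>j. B j) \<in> null_sets M"
        using B_sets by (intro null_sets_UN) (auto simp: null_sets_def)
      moreover have "{x \<in> space M. \<not> (f x \<noteq> 0 \<longrightarrow> 1 < W x)} \<subseteq> (\<Union>j. B j)"
      proof
        fix x assume "x \<in> {x \<in> space M. \<not> (f x \<noteq> 0 \<longrightarrow> 1 < W x)}"
        then have x: "f x \<noteq> 0" "W x \<le> 1" by auto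
        then have "0 < norm (f x) powr p" by simp
        then obtain j where "inverse (real (Suc j)) < norm (f x) powr p"
          using reals_Archimedean by blast
        then show "x \<in> (\<Union>j. B j)"
          using x by (auto simp: B_def inverse_eq_divide intro!: exI[of _ j])
      qed
      ultimately have W_gt_1: "AE x in M. f x \<noteq> 0 \<longrightarrow> 1 < W x"
        by (rule AE_I')
      \<comment> \<open>The cut-off makes the bound by \<open>f\<close> and the limit 0 hold at
        every point. It alters the function on a null set only, since \<open>f\<close> vanishes
        almost everywhere on \<open>{x. W x \<le> 1}\<close>. The exponent \<open>Suc k\<close>
        keeps the iteration count \<open>Suc k * \<gamma>\<close> positive.\<close>
      define g where "g k x = complex_of_real (inverse (W x ^ Suc k)) * f x * indicator {x. 1 < W x} x" for k x
      have [measurable]: "g k \<in> borel_measurable M" for k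
        unfolding g_def[abs_def] by measurable
      have g_le: "norm (g k x) powr p \<le> norm (f x) powr p" for k x
      proof (cases "1 < W x")
        case True
        then have "inverse (W x ^ Suc k) \<le> 1"
          by (intro inverse_le_1_iff[THEN iffD2] disjI2 one_le_power) auto
        then have "norm (g k x) \<le> norm (f x)"
          using True W_pos[of x]
          by (simp add: g_def norm_mult norm_inverse norm_power mult_left_le_one_le del: power_Suc)
        then show ?thesis
          using p by (intro powr_mono2) auto
      qed (simp add: g_def)
      have g: "g k \<in> Lp_funs M p" for k
        using Bochner_Integration.integrable_bound[OF f_int, of "\<lambda>x. norm (g k x) powr p"] g_le
        by (auto simp: Lp_funs_def)
      have "(\<lambda>k. \<integral>x. norm (g k x) powr p \<partial>M) \<longlonglongrightarrow> (\<integral>x. 0 \<partial>M)"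
      proof (rule integral_dominated_convergence[OF _ _ f_int])
        show "AE x in M. (\<lambda>k. norm (g k x) powr p) \<longlonglongrightarrow> 0"
        proof (rule AE_I2)
          fix x
          show "(\<lambda>k. norm (g k x) powr p) \<longlonglongrightarrow> 0"
          proof (cases "1 < W x")
            case True
            then have "(\<lambda>k. inverse (W x) ^ Suc k * norm (f x)) \<longlonglongrightarrow> 0 * norm (f x)"
              by (intro tendsto_mult_right LIMSEQ_Suc LIMSEQ_power_zero) (simp add: inverse_less_1_iff)
            moreover have "norm (g k x) = inverse (W x) ^ Suc k * norm (f x)" for k
              using True by (simp add: g_def norm_mult norm_inverse norm_power power_inverse)
            ultimately have "(\<lambda>k. norm (g k x)) \<longlonglongrightarrow> 0"
              by simp
            then show ?thesis
              using p by (intro tendsto_zero_powrI[where b = p]) auto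
          qed (simp add: g_def)
        qed
      qed (use g_le in auto)
      then have g_lim: "(\<lambda>k. Lp_norm M p (g k)) \<longlonglongrightarrow> 0"
        by (simp add: Lp_norm_tendsto_0_iff[OF p])
      \<comment> \<open>The factor \<open>W x ^ Suc k\<close> cancels the one in \<open>g k\<close>,
        so the target is attained exactly for every \<open>k\<close>.\<close>
      have Sg: "Lp_class M p ((S ^^ (Suc k * \<gamma>)) (g k)) = y" for k
        unfolding y
      proof (rule Lp_class_cong)
        show "AE x in M. (S ^^ (Suc k * \<gamma>)) (g k) x = f x"
          using W_gt_1
        proof eventually_elim
          case (elim x)
          have "complex_of_real (W x ^ Suc k) \<noteq> 0"
            using W_pos[of x] by simp
          then show ?case
            using elim unfolding S_period g_def
            by (cases "f x = 0") (simp_all add: mult.assoc[symmetric] del: power_Suc of_real_power)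
        qed
      qed
      have y_dist: "Lp_dist M p y y = 0"
        by (simp add: y Lp_dist_class f Lp_norm_def)
      show "y \<in> ?J"
        unfolding extended_limit_set_def S_def[symmetric]
      proof (intro CollectI conjI exI)
        show "y \<in> Lp_space M p" by fact
        show "strict_mono (\<lambda>k. Suc k * \<gamma>)"
          using \<gamma>(1) by (auto intro!: strict_monoI)
        show "\<forall>k. 0 < Suc k * \<gamma>"
          using \<gamma>(1) by simp
        show "\<forall>k. Lp_class M p (g k) \<in> Lp_space M p"
          using g by (auto simp: Lp_space_def)
        show "(\<lambda>k. Lp_dist M p (Lp_class M p (g k)) (Lp_class M p (\<lambda>_. 0))) \<longlonglongrightarrow> 0"
          using g_lim by (simp add: Lp_dist_class_zero g)
        show "(\<lambda>k. Lp_dist M p ((Lp_lift M p S ^^ (Suc k * \<gamma>)) (Lp_class M p (g k))) y) \<longlonglongrightarrow> 0"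
          by (simp only: lift[OF g] Sg y_dist tendsto_const)
      qed
    qed
  qed
  finally show ?thesis .
qed

section \<open>The essential supremum condition on a single compact set\<close>

text \<open>Where \<open>W > 1\<close> its powers tend to infinity, uniformly off a set of small
  measure since \<open>F\<close> has finite measure. Where \<open>W \<le> 1\<close> all weight
  products share one bound on \<open>F\<close>, so a small enough \<open>\<epsilon>\<close> excludes
  almost all such points from \<open>E\<close>.\<close>

lemma null_weight_prod_period_le_1_iff_esssup:
  fixes M :: "'a::{topological_group_add,t2_space} measure"
  assumes M: "right_haar_measure M" and \<gamma>: "0 < \<gamma>" "multiple \<gamma> a = 0"
    and \<omega>: "weight \<omega>" and F: "compact F"
  shows "emeasure M (F \<inter> {x. weight_prod a \<omega> \<gamma> x \<le> 1}) = 0 \<longleftrightarrow>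
    (\<forall>\<epsilon> \<delta>. \<epsilon> > 0 \<and> \<delta> > 0 \<longrightarrow>
      (\<exists>n E. n \<ge> 1 \<and> E \<in> sets borel \<and> E \<subseteq> F \<and> emeasure M (F - E) < ennreal \<delta> \<and>
        esssup (restrict_space M E) (\<lambda>x. ereal (inverse (weight_prod a \<omega> n x))) < ereal \<epsilon>))"
proof -
  define W where "W = weight_prod a \<omega> \<gamma>"
  define A where "A = {x. W x \<le> 1}"
  note sets = right_haar_measure_sets[OF M]
  have space: "space M = UNIV"
    using sets by (metis sets_eq_imp_space_eq space_borel)
  have meas: "weight_prod a \<omega> n \<in> borel_measurable M" for n
    using borel_measurable_weight_prod[OF \<omega>] by (simp add: measurable_cong_sets[OF sets refl])
  have W_pos: "W x > 0" for x
    by (simp add: W_def weight_prod_pos \<omega>)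
  have W_meas [measurable]: "W \<in> borel_measurable M"
    unfolding W_def by (rule meas)
  have F_sets [measurable]: "F \<in> sets M"
    using F by (auto simp: sets intro: borel_compact)
  have A_sets [measurable]: "A \<in> sets M"
  proof -
    have "{x \<in> space M. W x \<le> 1} \<in> sets M" by measurable
    then show ?thesis by (simp add: A_def space)
  qed
  have W_power: "weight_prod a \<omega> (q * \<gamma> + r) x = W x ^ q * weight_prod a \<omega> r x" for q r x
    unfolding W_def by (rule weight_prod_period_mult_add[OF \<gamma>(2)])
  show ?thesis
    unfolding W_def[symmetric] A_def[symmetric]
  proof (intro iffI allI impI; (elim conjE)?)
    fix \<epsilon> \<delta> :: real
    assume null: "emeasure M (F \<inter> A) = 0" and \<epsilon>: "\<epsilon> > 0" and \<delta>: "\<delta> > 0"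
    \<comment> \<open>The points where \<open>Suc q\<close> periods are not yet enough. The factor 2
      leaves room for the strict inequality of the essential supremum. Removing \<open>A\<close>
      makes the sequence decreasing, as \<open>W > 1\<close> there.\<close>
    define R where "R q = F \<inter> {x. W x ^ Suc q \<le> 2 / \<epsilon>}" for q
    have R_sets: "R q - A \<in> sets M" for q
    proof -
      have "{x \<in> space M. W x ^ Suc q \<le> 2 / \<epsilon>} \<in> sets M" by measurable
      then show ?thesis by (simp add: R_def space sets.Int sets.Diff)
    qed
    have "(\<lambda>q. emeasure M (R q - A)) \<longlonglongrightarrow> emeasure M (\<Inter>q. R q - A)"
    proof (rule Lim_emeasure_decseq)
      show "decseq (\<lambda>q. R q - A)"
      proof (rule decseq_SucI, rule subsetI)
        fix q x assume x: "x \<in> R (Suc q) - A"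
        then have "W x ^ Suc q \<le> W x ^ Suc (Suc q)"
          by (intro power_increasing) (auto simp: A_def)
        then show "x \<in> R q - A"
          using x by (auto simp: R_def simp del: power_Suc)
      qed
      have "emeasure M (R q - A) \<le> emeasure M F" for q
        using F_sets by (intro emeasure_mono) (auto simp: R_def)
      then show "emeasure M (R q - A) \<noteq> \<infinity>" for q
        using right_haar_measure_compact[OF M F] by (metis infinity_ennreal_def leD)
    qed (use R_sets in auto)
    \<comment> \<open>At each point outside \<open>A\<close> the powers of \<open>W\<close>
      eventually exceed \<open>2 / \<epsilon>\<close>.\<close>
    moreover have "(\<Inter>q. R q - A) = {}"
    proof (rule ccontr)
      assume "(\<Inter>q. R q - A) \<noteq> {}"
      then obtain x where x: "\<And>q. x \<in> R q - A" by auto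
      have "1 < W x" using x[of 0] by (simp add: A_def)
      then obtain q where "2 / \<epsilon> < W x ^ q"
        using real_arch_pow by blast
      also have "\<dots> \<le> W x ^ Suc q"
        using \<open>1 < W x\<close> by (intro power_increasing) auto
      finally show False
        using x[of q] by (auto simp: R_def)
    qed
    ultimately have "(\<lambda>q. emeasure M (R q - A)) \<longlonglongrightarrow> 0"
      by (simp only: emeasure_empty)
    then have "\<forall>\<^sub>F q in sequentially. emeasure M (R q - A) < ennreal \<delta>"
      by (rule order_tendstoD) (use \<delta> in simp)
    then obtain q where q: "emeasure M (R q - A) < ennreal \<delta>"
      by (auto simp: eventually_sequentially)
    \<comment> \<open>Only the null part \<open>F \<inter> A\<close> and the small set
      \<open>R q - A\<close> are lost. The matching exponent is
      \<open>n = Suc q * \<gamma>\<close>.\<close>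
    define E where "E = F - A - R q"
    have E_sets: "E \<in> sets M"
    proof -
      have "E = (F - A) - (R q - A)" by (auto simp: E_def)
      then show ?thesis using R_sets[of q] by simp
    qed
    have "emeasure M (F - E) \<le> emeasure M ((F \<inter> A) \<union> (R q - A))"
      using R_sets by (intro emeasure_mono) (auto simp: E_def)
    also have "\<dots> \<le> emeasure M (F \<inter> A) + emeasure M (R q - A)"
      using R_sets by (intro emeasure_subadditive) auto
    finally have FE: "emeasure M (F - E) < ennreal \<delta>"
      using q by (simp add: null)
    have "esssup (restrict_space M E) (\<lambda>x. ereal (inverse (weight_prod a \<omega> (Suc q * \<gamma>) x))) \<le> ereal (\<epsilon> / 2)"
    proof (rule esssup_I)
      show "(\<lambda>x. ereal (inverse (weight_prod a \<omega> (Suc q * \<gamma>) x))) \<in> borel_measurable (restrict_space M E)"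
        by (intro measurable_restrict_space1 borel_measurable_ereal borel_measurable_inverse meas)
      have "inverse (weight_prod a \<omega> (Suc q * \<gamma>) x) \<le> \<epsilon> / 2" if "x \<in> E" for x
      proof -
        have "2 / \<epsilon> < W x ^ Suc q"
          using that by (auto simp: E_def R_def)
        then have "inverse (W x ^ Suc q) \<le> inverse (2 / \<epsilon>)"
          using \<epsilon> by (intro le_imp_inverse_le) auto
        then show ?thesis
          using W_power[of "Suc q" 0 x] by (simp add: weight_prod_def[of a \<omega> 0])
      qed
      then show "AE x in restrict_space M E. ereal (inverse (weight_prod a \<omega> (Suc q * \<gamma>) x)) \<le> ereal (\<epsilon> / 2)"
        by (intro AE_I2) (simp add: space_restrict_space)
    qed
    also have "\<dots> < ereal \<epsilon>"
      using \<epsilon> by simp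
    finally have "esssup (restrict_space M E) (\<lambda>x. ereal (inverse (weight_prod a \<omega> (Suc q * \<gamma>) x))) < ereal \<epsilon>" .
    moreover have "Suc q * \<gamma> \<ge> 1"
      using \<gamma>(1) by simp
    moreover have "E \<subseteq> F"
      by (auto simp: E_def)
    ultimately show "\<exists>n E. n \<ge> 1 \<and> E \<in> sets borel \<and> E \<subseteq> F \<and> emeasure M (F - E) < ennreal \<delta> \<and>
        esssup (restrict_space M E) (\<lambda>x. ereal (inverse (weight_prod a \<omega> n x))) < ereal \<epsilon>"
      using E_sets FE unfolding sets by blast
  next
    assume *: "\<forall>\<epsilon> \<delta>. \<epsilon> > 0 \<and> \<delta> > 0 \<longrightarrow>
      (\<exists>n E. n \<ge> 1 \<and> E \<in> sets borel \<and> E \<subseteq> F \<and> emeasure M (F - E) < ennreal \<delta> \<and>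
        esssup (restrict_space M E) (\<lambda>x. ereal (inverse (weight_prod a \<omega> n x))) < ereal \<epsilon>)"
    \<comment> \<open>The finitely many remainder products are continuous, hence have a common bound
      \<open>C\<close> on the compact set \<open>F\<close>. On \<open>F \<inter> A\<close> it bounds
      every weight product, which motivates the choice
      \<open>\<epsilon> = inverse C\<close>.\<close>
    have "bounded (weight_prod a \<omega> r ` F)" for r
      by (intro compact_imp_bounded compact_continuous_image continuous_on_weight_prod \<omega> F)
    then have "bounded (\<Union>r<\<gamma>. weight_prod a \<omega> r ` F)"
      by (intro bounded_UN) auto
    then obtain C where C: "C > 0" "\<And>r x. r < \<gamma> \<Longrightarrow> x \<in> F \<Longrightarrow> \<bar>weight_prod a \<omega> r x\<bar> \<le> C"
      by (auto simp: bounded_pos)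
    have small: "emeasure M (F \<inter> A) < ennreal \<delta>" if "\<delta> > 0" for \<delta>
    proof -
      obtain n E where E: "E \<in> sets M" "E \<subseteq> F" "emeasure M (F - E) < ennreal \<delta>"
        and ess: "esssup (restrict_space M E) (\<lambda>x. ereal (inverse (weight_prod a \<omega> n x))) < ereal (inverse C)"
        using *[rule_format, of "inverse C" \<delta>] C(1) \<open>\<delta> > 0\<close> unfolding sets by auto
      have "AE x in restrict_space M E. ereal (inverse (weight_prod a \<omega> n x)) < ereal (inverse C)"
        using esssup_AE[of "\<lambda>x. ereal (inverse (weight_prod a \<omega> n x))" "restrict_space M E"]
        by eventually_elim (rule le_less_trans[OF _ ess])
      then have "AE x in M. x \<in> E \<longrightarrow> inverse (weight_prod a \<omega> n x) < inverse C"
        using E(1) by (simp add: AE_restrict_space_iff space)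
      \<comment> \<open>Almost everywhere on \<open>E\<close> the product of length \<open>n\<close>
        exceeds \<open>C\<close>, which is impossible on \<open>F \<inter> A\<close>.\<close>
      then have "AE x in M. x \<in> F \<inter> A \<longrightarrow> x \<in> F - E"
      proof eventually_elim
        case (elim x)
        have "\<not> inverse (weight_prod a \<omega> n x) < inverse C" if x: "x \<in> F \<inter> A"
        proof -
          have "weight_prod a \<omega> n x = W x ^ (n div \<gamma>) * weight_prod a \<omega> (n mod \<gamma>) x"
            using W_power[of "n div \<gamma>" "n mod \<gamma>" x] by simp
          also have "\<dots> \<le> 1 * C"
            using x W_pos[of x] C(2)[of "n mod \<gamma>" x] \<gamma>(1) weight_prod_pos[OF \<omega>, of a "n mod \<gamma>" x]
            by (intro mult_mono power_le_one) (auto simp: A_def)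
          finally show ?thesis
            using weight_prod_pos[OF \<omega>, of a n x] by (simp add: not_less le_imp_inverse_le)
        qed
        then show ?case using elim by auto
      qed
      then have "emeasure M (F \<inter> A) \<le> emeasure M (F - E)"
        using E(1) by (intro emeasure_mono_AE) auto
      then show ?thesis using E(3) by simp
    qed
    show "emeasure M (F \<inter> A) = 0"
    proof (rule ccontr)
      assume "emeasure M (F \<inter> A) \<noteq> 0"
      \<comment> \<open>Lying strictly below another value, \<open>d\<close> is finite, so its real
        value is an admissible \<open>\<delta>\<close>.\<close>
      then obtain d where d: "0 < d" "d < emeasure M (F \<inter> A)"
        using dense[of 0 "emeasure M (F \<inter> A)"] by (auto simp: zero_less_iff_neq_zero)
      then show False
        using small[of "enn2real d"] by (cases d) (auto simp: not_less less_imp_le)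
    qed
  qed
qed

theorem theorem2p4:
  fixes M :: "'a::{topological_group_add,t2_space} measure"
    and p :: real and a :: 'a and \<gamma> :: nat and \<omega> :: "'a \<Rightarrow> real"
  assumes "locally_compact_space (euclidean :: 'a topology)"
    and "right_haar_measure M"
    and "1 \<le> p"
    and "has_order a \<gamma>"
    and "weight \<omega>"
    and "Lp_bounded_linear M p (weighted_translation a \<omega>)"
  shows "extended_limit_set (Lp_space M p) (Lp_dist M p)
           (Lp_lift M p (weighted_translation a \<omega>)) (Lp_class M p (\<lambda>_. 0)) = Lp_space M p
     \<longleftrightarrow>
     (\<forall>F \<epsilon> \<delta>. compact F \<and> emeasure M F > 0 \<and> \<epsilon> > 0 \<and> \<delta> > 0 \<longrightarrow>
        (\<exists>n E. n \<ge> 1 \<and> E \<in> sets borel \<and> E \<subseteq> F \<and> emeasure M (F - E) < ennreal \<delta> \<and>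
           esssup (restrict_space M E) (\<lambda>x. ereal (inverse (weight_prod a \<omega> n x))) < ereal \<epsilon>))"
    (is "_ \<longleftrightarrow> ?E")
proof -
  have \<gamma>: "0 < \<gamma>" "multiple \<gamma> a = 0"
    using assms(4) by (auto simp: has_order_def)
  let ?A = "{x. weight_prod a \<omega> \<gamma> x \<le> 1}"
  \<comment> \<open>Condition (ii) ranges over compact sets of positive measure only; for null sets
    the intermediate condition is automatic.\<close>
  have "emeasure M (F \<inter> ?A) = 0" if "compact F" "emeasure M F = 0" for F
    using emeasure_mono[of "F \<inter> ?A" F M] that right_haar_measure_sets[OF assms(2)]
    by (auto intro: borel_compact)
  then have "(\<forall>F. compact F \<longrightarrow> emeasure M (F \<inter> ?A) = 0) \<longleftrightarrow>
      (\<forall>F. compact F \<and> emeasure M F > 0 \<longrightarrow> emeasure M (F \<inter> ?A) = 0)"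
    by (metis zero_less_iff_neq_zero)
  also have "\<dots> \<longleftrightarrow> ?E"
    by (simp add: null_weight_prod_period_le_1_iff_esssup[OF assms(2) \<gamma> assms(5)] cong: conj_cong imp_cong) blast
  finally show ?thesis
    using extended_limit_set_zero_eq_Lp_space_iff[OF assms(2) _ \<gamma> assms(5,6)] assms(3)
    by simp
qed

end
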